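(* Let $K \subseteq \mathbb{R}^n$ be a convex body, let $c, d \in \mathbb{R}^n$ be vectors, and let $R \geq r > 0$ be reals such that $r \mathbb{B}^n + c \subseteq K \subseteq R \mathbb{B}^n + d$. Then the following conditions are equivalent: (i) $d_{BM}(K, \mathbb{B}^n) = \frac{R}{r}$. (ii) For any real symmetric matrix $A \in \mathbb{R}^{n \times n}$ and any vectors $v, w \in \mathbb{R}^n$, there exist an inner contact point $y \in \operatorname{bd}(K) \cap \operatorname{bd}(r \mathbb{B}^n + c)$ and an outer contact point $z \in \operatorname{bd}(K) \cap \operatorname{bd}(R \mathbb{B}^n + d)$ such that $$\left\langle \frac{y-c}{r}, A \left( \frac{y-c}{r} \right) + v \right\rangle \leq \left\langle \frac{z-d}{R}, A \left( \frac{z-d}{R} \right) + w \right\rangle.$$ (iii) There exist integers $N, M \geq 1$, inner contact points $y^1, \ldots, y^N \in \operatorname{bd}(K) \cap \operatorname{bd}(r \mathbb{B}^n + c)$, outer contact points $z^1, \ldots, z^M \in \operatorname{bd}(K) \cap \operatorname{bd}(R \mathbb{B}^n + d)$, as well as weights $\lambda_1, \ldots, \lambda_N, \mu_1, \ldots, \mu_M > 0$ such that for any $x \in \mathbb{R}^n$, $$\sum_{i=1}^N \lambda_i \langle x, y^i - c \rangle (y^i - c) = \sum_{j=1}^M \mu_j \langle x, z^j - d \rangle (z^j - d) \quad \text{and} \quad \sum_{i=1}^N \lambda_i (y^i - c) = \sum_{j=1}^M \mu_j (z^j - d) = 0.$$ In this case (i.e., for a decomposition as in (iii)), $r^2 \sum_{i=1}^N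 \lambda_i = R^2 \sum_{j=1}^M \mu_j$, and there exists a choice of the decomposition in (iii) with $N + M \leq \frac{n(n+5)}{2} + 1$.
   Context: A convex body in $\mathbb{R}^n$ is a compact convex set with non-empty interior. $\mathbb{B}^n$ is the (closed) Euclidean unit ball in $\mathbb{R}^n$, $\langle \cdot, \cdot \rangle$ is the standard inner product, and $\operatorname{bd}$ denotes boundary. The Banach--Mazur distance of convex bodies $K, L \subseteq \mathbb{R}^n$ is $$d_{BM}(K,L) := \inf \{ \rho \geq 0 : K + u \subseteq T(L + v) \subseteq \rho (K + u) \},$$ where the infimum runs over all invertible linear operators $T$ on $\mathbb{R}^n$ and all translation vectors $u, v \in \mathbb{R}^n$. *)

theory Defs
  imports "HOL-Analysis.Analysis"
begin

definition convex_body :: "'a::euclidean_space set \<Rightarrow> bool" where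
  "convex_body K \<longleftrightarrow> compact K \<and> convex K \<and> interior K \<noteq> {}"

text \<open>For convex bodies the set of admissible factors is nonempty and bounded below, so the
  real-valued infimum is the intended one.\<close>

definition banach_mazur_dist :: "'a::euclidean_space set \<Rightarrow> 'a set \<Rightarrow> real" where
  "banach_mazur_dist K L = Inf {\<rho>. \<rho> \<ge> 0 \<and>
     (\<exists>T u v. linear T \<and> bij T \<and>
        (\<lambda>x. x + u) ` K \<subseteq> T ` ((\<lambda>x. x + v) ` L) \<and>
        T ` ((\<lambda>x. x + v) ` L) \<subseteq> (\<lambda>x. \<rho> *\<^sub>R x) ` ((\<lambda>x. x + u) ` K))}"

text \<open>Points where the boundary of \<open>K\<close> meets the boundary of the ball with centre \<open>p\<close> and
  radius \<open>s\<close>: inner contact points if the ball lies in \<open>K\<close>, outer ones if it contains \<open>K\<close>.\<close>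

definition contact_points :: "'a::euclidean_space set \<Rightarrow> 'a \<Rightarrow> real \<Rightarrow> 'a set" where
  "contact_points K p s = frontier K \<inter> frontier (cball p s)"

definition contact_decomposition ::
  "'a::euclidean_space set \<Rightarrow> 'a \<Rightarrow> real \<Rightarrow> 'a \<Rightarrow> real \<Rightarrow> nat \<Rightarrow> nat \<Rightarrow>
   (nat \<Rightarrow> 'a) \<Rightarrow> (nat \<Rightarrow> 'a) \<Rightarrow> (nat \<Rightarrow> real) \<Rightarrow> (nat \<Rightarrow> real) \<Rightarrow> bool" where
  "contact_decomposition K c r d R N M y z lam mu \<longleftrightarrow>
     N \<ge> 1 \<and> M \<ge> 1 \<and>
     (\<forall>i\<in>{1..N}. y i \<in> contact_points K c r \<and> lam i > 0) \<and>
     (\<forall>j\<in>{1..M}. z j \<in> contact_points K d R \<and> mu j > 0) \<and>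
     (\<forall>x. (\<Sum>i=1..N. lam i *\<^sub>R ((x \<bullet> (y i - c)) *\<^sub>R (y i - c)))
        = (\<Sum>j=1..M. mu j *\<^sub>R ((x \<bullet> (z j - d)) *\<^sub>R (z j - d)))) \<and>
     (\<Sum>i=1..N. lam i *\<^sub>R (y i - c)) = 0 \<and>
     (\<Sum>j=1..M. mu j *\<^sub>R (z j - d)) = 0"

end

theory Submission
  imports Defs
begin

text \<open>
  The three conditions are shown equivalent in a cycle: a contact decomposition forces the distance
  to be \<open>R / r\<close>, that distance forces the balance condition on quadratic forms, and the balance
  condition yields a contact decomposition which is already short.

  A factor \<open>\<rho>\<close> is admissible, up to translations, when \<open>K\<close> lies between two homothetic ellipsoids
  of ratio \<open>\<rho>\<close>; the translations in the definition of the distance absorb the two centres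
  (\<open>banach_mazur_dist_ball_le\<close>).

  Decomposition to distance: let an ellipsoid with linear part \<open>T\<close> contain \<open>K\<close> and its \<open>s\<close>-fold
  homothet be contained in \<open>K\<close>. At an inner contact point with unit normal \<open>p\<close> the body and the
  inner ball share a tangent hyperplane, so the small ellipsoid gives an upper bound for the norm of
  the adjoint of \<open>T\<close> at \<open>p\<close>. The outer contact points lie in the large ellipsoid, which bounds the
  norm of the inverse of \<open>T\<close> there. In the weighted averages the centres cancel because the
  contact directions sum to zero, and the equality of the two second moments moves the second bound
  to the inner contact points. There the two norms have product at least one by the Cauchy-Schwarz
  inequality, and convexity gives \<open>s * R \<le> r\<close> (\<open>contact_decomposition_ellipsoid_ratio\<close>).

  Distance to balance: suppose that some \<open>A\<close>, \<open>v\<close>, \<open>w\<close> violate the balance condition. After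
  subtracting a multiple of the identity from \<open>A\<close>, the first form is positive on all inner and the
  second negative on all outer contact directions. Replace the two balls by the ellipsoids with
  linear part \<open>inv (I + t * A)\<close> and centres moved along \<open>v\<close> and \<open>w\<close>. To first order in \<open>t\<close> both
  leave the boundary of \<open>K\<close> at their contact points, and by compactness they do so everywhere for
  small \<open>t\<close>; hence the ratio can be improved (\<open>improved_ellipsoids\<close>).

  Balance to decomposition: after normalising the weights, a contact decomposition says that zero
  is a convex combination of the points \<open>(y y\<^sup>T, y, 0)\<close> and \<open>(- z z\<^sup>T, 0, z)\<close> given by the contact directions, and a hyperplane
  separating zero from their convex hull is exactly a violation of the balance condition. These
  points live in a space of dimension \<open>n(n+1)/2 + 2n\<close>, so Caratheodory's theorem provides a
  combination of at most \<open>n(n+5)/2 + 1\<close> of them.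
\<close>

section \<open>Admissible factors and pairs of homothetic ellipsoids\<close>

text \<open>Both inclusions of the definition refer to the same translation of \<open>K\<close>, and the scaling is
  about the origin. Hence \<open>K\<close> has to be translated so that the centre of homothety of the two
  ellipsoids becomes the origin, which is possible for ratios different from one. Since larger
  factors are admissible too, the infimum obeys the bound even when \<open>R = r\<close>. The second claim
  makes the infimum one over a nonempty set.\<close>

lemma banach_mazur_dist_ball_le:
  fixes K :: "'a::euclidean_space set"
    and T :: "'a \<Rightarrow> 'a"
  assumes T: "linear T" "bij T" and r: "r > 0" and R: "R > 0"
    and out: "K \<subseteq> (\<lambda>x. a + R *\<^sub>R T x) ` cball 0 1"
    and inn: "(\<lambda>x. b + r *\<^sub>R T x) ` cball 0 1 \<subseteq> K"
  shows "banach_mazur_dist K (cball 0 1) \<le> R / r"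
    and "{\<rho>. \<rho> \<ge> 0 \<and> (\<exists>T u v. linear T \<and> bij T \<and>
        (\<lambda>x. x + u) ` K \<subseteq> T ` ((\<lambda>x. x + v) ` cball (0::'a) 1) \<and>
        T ` ((\<lambda>x. x + v) ` cball 0 1) \<subseteq> (\<lambda>x. \<rho> *\<^sub>R x) ` ((\<lambda>x. x + u) ` K))} \<noteq> {}"
proof -
  define adm where "adm = {\<rho>. \<rho> \<ge> 0 \<and> (\<exists>T u v. linear T \<and> bij T \<and>
        (\<lambda>x. x + u) ` K \<subseteq> T ` ((\<lambda>x. x + v) ` cball (0::'a) 1) \<and>
        T ` ((\<lambda>x. x + v) ` cball 0 1) \<subseteq> (\<lambda>x. \<rho> *\<^sub>R x) ` ((\<lambda>x. x + u) ` K))}"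
  have adm: "\<rho> \<in> adm" if \<rho>: "\<rho> \<ge> R / r" "\<rho> \<noteq> 1" for \<rho>
  proof -
    have \<rho>0: "\<rho> > 0" using \<rho> r R by (smt (verit) divide_pos_pos)
    have Rle: "R \<le> \<rho> * r" using \<rho> r by (simp add: field_simps)
    define S where "S = (\<lambda>x. (\<rho> * r) *\<^sub>R T x)"
    have linS: "linear S" unfolding S_def using T(1) by (simp add: linear_compose_scale_right)
    have bijS: "bij S"
    proof -
      have "S = (\<lambda>x. (\<rho> * r) *\<^sub>R x) \<circ> T" by (auto simp: S_def)
      moreover have "bij (\<lambda>x::'a. (\<rho> * r) *\<^sub>R x)"
        using \<rho>0 r by (intro o_bij[of "\<lambda>x. (1 / (\<rho> * r)) *\<^sub>R x"]) (auto simp: fun_eq_iff)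
      ultimately show ?thesis using T(2) by (simp add: bij_comp)
    qed
    \<comment> \<open>The translation that moves the centre of homothety between the two ellipsoids to the origin.\<close>
    define u where "u = (1 / (\<rho> - 1)) *\<^sub>R (a - \<rho> *\<^sub>R b)"
    have u: "a + u = \<rho> *\<^sub>R (b + u)"
    proof -
      have "(\<rho> - 1) *\<^sub>R u = a - \<rho> *\<^sub>R b" using \<rho> by (simp add: u_def)
      then show ?thesis by (simp add: algebra_simps)
    qed
    obtain v where v: "S v = a + u" using bijS by (metis bij_pointE)
    have "(\<lambda>x. x + u) ` K \<subseteq> S ` ((\<lambda>x. x + v) ` cball 0 1)"
    proof clarify
      fix x assume "x \<in> K"
      then obtain e where e: "norm e \<le> 1" "x = a + R *\<^sub>R T e" using out by auto
      define e' where "e' = (R / (\<rho> * r)) *\<^sub>R e"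
      have "R / (\<rho> * r) \<le> 1" using Rle \<rho>0 r by simp
      then have "norm e' \<le> 1 * 1"
        unfolding e'_def norm_scaleR using e(1) R \<rho>0 r by (intro mult_mono) auto
      then have "norm e' \<le> 1" by simp
      moreover have "S (e' + v) = x + u"
        using \<rho>0 r by (simp add: linear_add[OF linS] v e) 
          (simp add: S_def e'_def linear_cmul[OF T(1)])
      ultimately show "x + u \<in> S ` ((\<lambda>x. x + v) ` cball 0 1)"
        by (metis image_eqI mem_cball_0)
    qed
    moreover have "S ` ((\<lambda>x. x + v) ` cball 0 1) \<subseteq> (\<lambda>x. \<rho> *\<^sub>R x) ` ((\<lambda>x. x + u) ` K)"
    proof clarify
      fix e :: 'a assume e: "e \<in> cball 0 1"
      have "b + r *\<^sub>R T e \<in> K" using inn e by blast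
      moreover have "S (e + v) = \<rho> *\<^sub>R (b + r *\<^sub>R T e + u)"
        by (simp add: linear_add[OF linS] v u) (simp add: S_def algebra_simps)
      ultimately show "S (e + v) \<in> (\<lambda>x. \<rho> *\<^sub>R x) ` ((\<lambda>x. x + u) ` K)"
        by blast
    qed
    ultimately show ?thesis unfolding adm_def using linS bijS \<rho>0 by fastforce
  qed
  have bm: "banach_mazur_dist K (cball 0 1) = Inf adm"
    unfolding banach_mazur_dist_def adm_def ..
  have bdd: "bdd_below adm" unfolding adm_def by (auto intro!: bdd_belowI[of _ 0])
  show "banach_mazur_dist K (cball 0 1) \<le> R / r"
  proof (rule field_le_epsilon)
    fix e :: real assume e: "e > 0"
    obtain \<rho> where "\<rho> \<ge> R / r" "\<rho> \<le> R / r + e" "\<rho> \<noteq> 1"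
      by (rule that[of "if R / r + e = 1 then R / r + e / 2 else R / r + e"]) (use e in \<open>auto split: if_splits\<close>)
    then show "banach_mazur_dist K (cball 0 1) \<le> R / r + e"
      using adm cInf_lower[OF _ bdd] unfolding bm by (meson order_trans)
  qed
  have "R / r + 1 \<in> adm" using r R by (intro adm) auto
  then have "adm \<noteq> {}" by blast
  then show "{\<rho>. \<rho> \<ge> 0 \<and> (\<exists>T u v. linear T \<and> bij T \<and>
        (\<lambda>x. x + u) ` K \<subseteq> T ` ((\<lambda>x. x + v) ` cball (0::'a) 1) \<and>
        T ` ((\<lambda>x. x + v) ` cball 0 1) \<subseteq> (\<lambda>x. \<rho> *\<^sub>R x) ` ((\<lambda>x. x + u) ` K))} \<noteq> {}"
    unfolding adm_def .
qed

lemma ball_sandwich_ellipsoids: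
  fixes K :: "'a::euclidean_space set"
  assumes r: "r > 0" and R: "R > 0" and sub: "cball c r \<subseteq> K" and sup: "K \<subseteq> cball d R"
  shows "K \<subseteq> (\<lambda>x. d + R *\<^sub>R id x) ` cball 0 1" and "(\<lambda>x. c + r *\<^sub>R id x) ` cball 0 1 \<subseteq> K"
proof -
  show "K \<subseteq> (\<lambda>x. d + R *\<^sub>R id x) ` cball 0 1"
  proof
    fix x assume "x \<in> K"
    then have "norm (x - d) \<le> R" using sup by (auto simp: dist_norm norm_minus_commute)
    then show "x \<in> (\<lambda>x. d + R *\<^sub>R id x) ` cball 0 1"
      using R by (intro image_eqI[of _ _ "(1 / R) *\<^sub>R (x - d)"]) auto
  qed
  show "(\<lambda>x. c + r *\<^sub>R id x) ` cball 0 1 \<subseteq> K" using sub r by (auto simp: dist_norm)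
qed

lemma banach_mazur_dist_le_ratio:
  fixes K :: "'a::euclidean_space set"
  assumes "r > 0" "R > 0" "cball c r \<subseteq> K" "K \<subseteq> cball d R"
  shows "banach_mazur_dist K (cball 0 1) \<le> R / r"
  by (rule banach_mazur_dist_ball_le(1)[OF linear_id bij_id assms(1,2) ball_sandwich_ellipsoids[OF assms]])

section \<open>A contact decomposition bounds the distance from below\<close>

text \<open>A hyperplane supporting \<open>K\<close> at \<open>y\<close> also supports the inscribed ball there, and equality in the
  Cauchy-Schwarz inequality identifies its normal as a multiple of \<open>y - c\<close>.\<close>

lemma support_at_inner_contact:
  fixes K :: "'a::euclidean_space set"
  assumes K: "convex_body K" and r: "r > 0" and sub: "cball c r \<subseteq> K"
    and y: "y \<in> contact_points K c r" and x: "x \<in> K"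
  shows "(x - c) \<bullet> (y - c) \<le> r\<^sup>2"
proof -
  have cl: "closed K" and conv: "convex K" and int: "interior K \<noteq> {}"
    using K by (auto simp: convex_body_def compact_imp_closed)
  have yK: "y \<in> frontier K" and yr: "norm (y - c) = r"
    using y r by (auto simp: contact_points_def frontier_cball dist_norm norm_minus_commute)
  have yK: "y \<in> K" "y \<notin> rel_interior K"
    using yK int closure_closed[OF cl] by (simp_all add: frontier_def rel_interior_nonempty_interior)
  obtain a where a: "a \<noteq> 0" "\<And>x. x \<in> K \<Longrightarrow> a \<bullet> y \<le> a \<bullet> x"
    using supporting_hyperplane_rel_boundary[OF conv yK] by metis
  have "c - (r / norm a) *\<^sub>R a \<in> K" using sub r a(1) by (auto simp: dist_norm)
  from a(2)[OF this] have "r * norm a \<le> a \<bullet> (c - y)"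
    using a(1) by (simp add: inner_diff_right dot_square_norm power2_eq_square)
  moreover have "a \<bullet> (c - y) \<le> norm a * norm (c - y)" by (rule norm_cauchy_schwarz)
  ultimately have "a \<bullet> (c - y) = norm a * norm (c - y)"
    using yr by (simp add: norm_minus_commute mult.commute)
  then have par: "norm a *\<^sub>R (c - y) = r *\<^sub>R a"
    using yr by (simp add: norm_cauchy_schwarz_eq norm_minus_commute)
  have "0 \<le> r * (a \<bullet> (x - y))"
    using a(2)[OF x] r by (simp add: inner_diff_right)
  also have "\<dots> = norm a * ((c - y) \<bullet> (x - y))"
    using arg_cong[OF par, of "\<lambda>b. b \<bullet> (x - y)"] by simp
  finally have "0 \<le> (c - y) \<bullet> (x - y)" using a(1) by (simp add: zero_le_mult_iff)
  then have "(x - c) \<bullet> (y - c) \<le> (y - c) \<bullet> (y - c)"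
    by (simp add: algebra_simps inner_commute)
  then show ?thesis using yr by (simp add: dot_square_norm)
qed

text \<open>The decomposition says that the two families have equal second moment operators; the weighted
  average of a squared norm after a linear map depends on that operator only.\<close>

lemma contact_decomposition_norm_squares:
  fixes K :: "'a::euclidean_space set" and f :: "'a \<Rightarrow> 'b::euclidean_space"
  assumes dec: "contact_decomposition K c r d R N M y z lam mu" and f: "linear f"
  shows "(\<Sum>i=1..N. lam i * (norm (f (y i - c)))\<^sup>2) = (\<Sum>j=1..M. mu j * (norm (f (z j - d)))\<^sup>2)"
proof -
  have eq: "(\<Sum>i=1..N. lam i * (u \<bullet> (y i - c))\<^sup>2) = (\<Sum>j=1..M. mu j * (u \<bullet> (z j - d))\<^sup>2)" for u
  proof -
    have "(\<Sum>i=1..N. lam i *\<^sub>R ((u \<bullet> (y i - c)) *\<^sub>R (y i - c)))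
        = (\<Sum>j=1..M. mu j *\<^sub>R ((u \<bullet> (z j - d)) *\<^sub>R (z j - d)))"
      using dec by (simp add: contact_decomposition_def)
    from arg_cong[OF this, of "inner u"] show ?thesis
      by (simp add: inner_sum_right power2_eq_square mult.assoc)
  qed
  have "(norm (f p))\<^sup>2 = (\<Sum>b\<in>Basis. (adjoint f b \<bullet> p)\<^sup>2)" for p
  proof -
    have "f p \<bullet> b = adjoint f b \<bullet> p" for b
      using adjoint_works[OF f, of p b] by (metis inner_commute)
    then show ?thesis
      unfolding power2_norm_eq_inner by (subst euclidean_inner) (simp add: power2_eq_square)
  qed
  then show ?thesis
    by (simp only: sum_distrib_left sum.swap[of _ Basis] eq)
qed

lemma contact_decomposition_weights:
  fixes K :: "'a::euclidean_space set"
  assumes dec: "contact_decomposition K c r d R N M y z lam mu" and "r > 0" "R > 0"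
  shows "r\<^sup>2 * (\<Sum>i=1..N. lam i) = R\<^sup>2 * (\<Sum>j=1..M. mu j)"
proof -
  have "\<And>i. i \<in> {1..N} \<Longrightarrow> norm (y i - c) = r" "\<And>j. j \<in> {1..M} \<Longrightarrow> norm (z j - d) = R"
    using dec assms(2,3)
    by (auto simp: contact_decomposition_def contact_points_def frontier_cball dist_norm
        norm_minus_commute)
  then show ?thesis
    using contact_decomposition_norm_squares[OF dec linear_ident]
    by (simp add: sum_distrib_left mult.commute)
qed

text \<open>The adjoint \<open>A\<close> of \<open>T\<close> gives the support function of the ellipsoids and the inverse \<open>S\<close> their gauge.
  The inner contact points control the average of \<open>norm (A p)\<close>, the outer ones that of
  \<open>(norm (S p))\<^sup>2\<close>, and \<open>A p \<bullet> S p = p \<bullet> p\<close> prevents both from being small.\<close>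

lemma contact_decomposition_ellipsoid_ratio:
  fixes K :: "'a::euclidean_space set" and T :: "'a \<Rightarrow> 'a"
  assumes K: "convex_body K" and r: "r > 0" and R: "R > 0" and sub: "cball c r \<subseteq> K"
    and dec: "contact_decomposition K c r d R N M y z lam mu"
    and T: "linear T" "bij T" and s: "s > 0"
    and out: "K \<subseteq> (\<lambda>x. a + T x) ` cball 0 1"
    and inn: "(\<lambda>x. b + s *\<^sub>R T x) ` cball 0 1 \<subseteq> K"
  shows "s * R \<le> r"
proof -
  have N: "N \<ge> 1" and lam: "\<And>i. i \<in> {1..N} \<Longrightarrow> lam i > 0"
    and mu: "\<And>j. j \<in> {1..M} \<Longrightarrow> mu j > 0"
    and yc: "\<And>i. i \<in> {1..N} \<Longrightarrow> y i \<in> contact_points K c r"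
    and zc: "\<And>j. j \<in> {1..M} \<Longrightarrow> z j \<in> contact_points K d R"
    and y0: "(\<Sum>i=1..N. lam i *\<^sub>R (y i - c)) = 0"
    and z0: "(\<Sum>j=1..M. mu j *\<^sub>R (z j - d)) = 0"
    using dec by (auto simp: contact_decomposition_def)
  have yn: "norm (y i - c) = r" if "i \<in> {1..N}" for i
    using yc[OF that] r by (auto simp: contact_points_def frontier_cball dist_norm norm_minus_commute)
  define S where "S = inv T"
  have S: "linear S" unfolding S_def using inj_linear_imp_inv_linear[OF T(1)] T(2) by (simp add: bij_is_inj)
  have TS: "T (S x) = x" and ST: "S (T x) = x" for x
    unfolding S_def using T(2) by (auto simp: bij_is_inj bij_is_surj surj_f_inv_f)
  define A where "A = adjoint T"
  have A: "A p \<bullet> q = p \<bullet> T q" for p q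
    unfolding A_def using adjoint_works[OF T(1)] by (metis inner_commute)
  define lamS where "lamS = (\<Sum>i=1..N. lam i)"
  define muS where "muS = (\<Sum>j=1..M. mu j)"
  have lamS: "lamS > 0" unfolding lamS_def using N lam by (intro sum_pos) auto
  have wt: "r\<^sup>2 * lamS = R\<^sup>2 * muS"
    unfolding lamS_def muS_def by (rule contact_decomposition_weights[OF dec r R])
  \<comment> \<open>The inner ellipsoid lies below the common tangent hyperplane at each inner contact point.\<close>
  have inner_bd: "s * norm (A (y i - c)) \<le> r\<^sup>2 - (b - c) \<bullet> (y i - c)" if i: "i \<in> {1..N}" for i
  proof -
    define p where "p = y i - c"
    define e where "e = sgn (A p)"
    have "norm e \<le> 1" by (simp add: e_def norm_sgn)
    then have "b + s *\<^sub>R T e \<in> K" using inn by (simp add: image_subset_iff)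
    from support_at_inner_contact[OF K r sub yc[OF i] this]
    have "(b - c) \<bullet> p + s * (p \<bullet> T e) \<le> r\<^sup>2"
      by (simp add: p_def algebra_simps inner_commute)
    moreover have "p \<bullet> T e = norm (A p)"
      unfolding A[symmetric] e_def sgn_div_norm
      by (cases "A p = 0") (simp_all add: dot_square_norm power2_eq_square)
    ultimately show ?thesis by (simp add: p_def)
  qed
  have "(\<Sum>i=1..N. lam i * (s * norm (A (y i - c))))
      \<le> (\<Sum>i=1..N. lam i * (r\<^sup>2 - (b - c) \<bullet> (y i - c)))"
    using inner_bd lam by (intro sum_mono mult_left_mono) (auto intro: less_imp_le)
  also have "\<dots> = r\<^sup>2 * lamS - (b - c) \<bullet> (\<Sum>i=1..N. lam i *\<^sub>R (y i - c))"
    by (simp add: lamS_def inner_sum_right right_diff_distrib sum_subtractf sum_distrib_left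
        sum_distrib_right mult.commute)
  finally have sumA: "s * (\<Sum>i=1..N. lam i * norm (A (y i - c))) \<le> r\<^sup>2 * lamS"
    unfolding y0 by (simp add: sum_distrib_left mult.left_commute)
  \<comment> \<open>The outer contact points lie in the outer ellipsoid; its centre drops out on average.\<close>
  have outer_bd: "(norm (S (z j - d)))\<^sup>2 + 2 * (S (z j - d) \<bullet> S (d - a)) \<le> 1" if j: "j \<in> {1..M}" for j
  proof -
    have "z j \<in> K"
      using zc[OF j] K
      by (metis Diff_iff IntE closure_closed compact_imp_closed contact_points_def
          convex_body_def frontier_def)
    then obtain e where e: "norm e \<le> 1" "z j = a + T e" using out by auto
    have "S (z j - d) + S (d - a) = e"
      by (simp add: linear_add[OF S, symmetric] e ST)
    then have "(norm (S (z j - d) + S (d - a)))\<^sup>2 \<le> 1" using e(1) by (simp add: power_le_one)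
    moreover have "(norm (S (z j - d) + S (d - a)))\<^sup>2 =
        (norm (S (z j - d)))\<^sup>2 + 2 * (S (z j - d) \<bullet> S (d - a)) + (norm (S (d - a)))\<^sup>2"
      by (simp add: power2_norm_eq_inner inner_add_left inner_add_right inner_commute)
    ultimately show ?thesis by (smt (verit) zero_le_power2)
  qed
  have "(\<Sum>j=1..M. mu j * ((norm (S (z j - d)))\<^sup>2 + 2 * (S (z j - d) \<bullet> S (d - a)))) \<le> (\<Sum>j=1..M. mu j * 1)"
    using outer_bd mu by (intro sum_mono mult_left_mono) (auto intro: less_imp_le)
  moreover have "(\<Sum>j=1..M. mu j * ((norm (S (z j - d)))\<^sup>2 + 2 * (S (z j - d) \<bullet> S (d - a))))
     = (\<Sum>j=1..M. mu j * (norm (S (z j - d)))\<^sup>2) + 2 * (S (\<Sum>j=1..M. mu j *\<^sub>R (z j - d)) \<bullet> S (d - a))"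
    by (simp add: linear_sum[OF S] linear_cmul[OF S] inner_sum_left distrib_left sum.distrib
        sum_distrib_left mult.left_commute)
  ultimately have "(\<Sum>j=1..M. mu j * (norm (S (z j - d)))\<^sup>2) \<le> muS"
    unfolding z0 by (simp add: linear_0[OF S] muS_def)
  then have sumS: "(\<Sum>i=1..N. lam i * (norm (S (y i - c)))\<^sup>2) \<le> muS"
    unfolding contact_decomposition_norm_squares[OF dec S] .
  \<comment> \<open>With \<open>t = R * norm (S p) / r\<close>, this is the tangent line bound \<open>1 / t \<ge> (3 - t\<^sup>2) / 2\<close>
    for the convex function \<open>1 / sqrt\<close> of \<open>t\<^sup>2\<close>, combined with
    \<open>r\<^sup>2 = A p \<bullet> S p \<le> norm (A p) * norm (S p)\<close>.\<close>
  have tangent: "R * (3 * r\<^sup>2 - R\<^sup>2 * (norm (S (y i - c)))\<^sup>2) \<le> 2 * r * norm (A (y i - c))"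
    if i: "i \<in> {1..N}" for i
  proof -
    define p where "p = y i - c"
    define \<alpha> where "\<alpha> = norm (A p)"
    define \<beta> where "\<beta> = norm (S p)"
    have "r\<^sup>2 = A p \<bullet> S p" using yn[OF i] by (simp add: A TS p_def dot_square_norm)
    also have "\<dots> \<le> \<alpha> * \<beta>" unfolding \<alpha>_def \<beta>_def by (rule norm_cauchy_schwarz)
    finally have ab: "r\<^sup>2 \<le> \<alpha> * \<beta>" .
    have "\<beta> \<ge> 0" by (simp add: \<beta>_def)
    with ab r have \<beta>: "\<beta> > 0" by (cases "\<beta> = 0") auto
    \<comment> \<open>The tangent line bound with denominators cleared: \<open>t^3 - 3 * t + 2 = (t - 1)^2 * (t + 2)\<close>.\<close>
    have "0 \<le> (R * \<beta> - r)\<^sup>2 * (R * \<beta> + 2 * r)" using R \<beta> r by simp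
    then have "\<beta> * (R * (3 * r\<^sup>2 - R\<^sup>2 * \<beta>\<^sup>2)) \<le> 2 * r * r\<^sup>2"
      by (simp add: algebra_simps power2_eq_square)
    also have "\<dots> \<le> \<beta> * (2 * r * \<alpha>)" using ab r by (simp add: mult_ac)
    finally show ?thesis using \<beta> by (simp add: \<alpha>_def \<beta>_def p_def)
  qed
  have "2 * R * (r\<^sup>2 * lamS) = R * (3 * r\<^sup>2 * lamS - R\<^sup>2 * muS)" using wt by (simp add: algebra_simps)
  also have "\<dots> \<le> R * (3 * r\<^sup>2 * lamS - R\<^sup>2 * (\<Sum>i=1..N. lam i * (norm (S (y i - c)))\<^sup>2))"
    using sumS R by (intro mult_left_mono diff_left_mono) auto
  also have "\<dots> = (\<Sum>i=1..N. lam i * (R * (3 * r\<^sup>2 - R\<^sup>2 * (norm (S (y i - c)))\<^sup>2)))"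
    by (simp add: lamS_def sum_distrib_left sum_subtractf[symmetric] algebra_simps)
  also have "\<dots> \<le> (\<Sum>i=1..N. lam i * (2 * r * norm (A (y i - c))))"
    using tangent lam by (intro sum_mono mult_left_mono) (auto intro: less_imp_le)
  also have "\<dots> = 2 * r * (\<Sum>i=1..N. lam i * norm (A (y i - c)))"
    by (simp add: sum_distrib_left mult.left_commute)
  finally have "s * (2 * R * (r\<^sup>2 * lamS)) \<le> s * (2 * r * (\<Sum>i=1..N. lam i * norm (A (y i - c))))"
    using s by simp
  also have "\<dots> \<le> 2 * r * (r\<^sup>2 * lamS)" using sumA r by (simp add: mult_ac)
  finally have "(s * R) * (2 * r\<^sup>2 * lamS) \<le> r * (2 * r\<^sup>2 * lamS)" by (simp add: mult_ac)
  moreover have "2 * r\<^sup>2 * lamS > 0" using r lamS by simp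
  ultimately show ?thesis by (simp add: mult_le_cancel_right)
qed

lemma contact_decomposition_imp_dist:
  fixes K :: "'a::euclidean_space set"
  assumes K: "convex_body K" and r: "r > 0" and R: "R > 0" and sub: "cball c r \<subseteq> K"
    and sup: "K \<subseteq> cball d R"
    and dec: "contact_decomposition K c r d R N M y z lam mu"
  shows "R / r \<le> banach_mazur_dist K (cball 0 1)"
  unfolding banach_mazur_dist_def
proof (rule cInf_greatest, goal_cases)
  case 1
  show ?case
    by (rule banach_mazur_dist_ball_le(2)[OF linear_id bij_id r R
          ball_sandwich_ellipsoids[OF r R sub sup]])
next
  case (2 \<rho>)
  then obtain T :: "'a \<Rightarrow> 'a" and u v where T: "linear T" "bij T" and \<rho>: "\<rho> \<ge> 0"
    and o: "(\<lambda>x. x + u) ` K \<subseteq> T ` ((\<lambda>x. x + v) ` cball 0 1)"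
    and i: "T ` ((\<lambda>x. x + v) ` cball 0 1) \<subseteq> (\<lambda>x. \<rho> *\<^sub>R x) ` ((\<lambda>x. x + u) ` K)"
    by (elim CollectE conjE exE) (rule that; assumption)
  have "\<rho> \<noteq> 0"
  proof
    assume "\<rho> = 0"
    have "c \<in> K" using sub r by auto
    obtain b :: 'a where b: "b \<in> Basis" using nonempty_Basis by blast
    have "c + r *\<^sub>R b \<in> K" using sub r b by (auto simp: dist_norm)
    have "x + u = 0" if "x \<in> K" for x
    proof -
      have "x + u \<in> (\<lambda>x. \<rho> *\<^sub>R x) ` ((\<lambda>x. x + u) ` K)"
        by (rule subsetD[OF i subsetD[OF o]]) (use that in simp)
      then show ?thesis using \<open>\<rho> = 0\<close> by auto
    qed
    from this[OF \<open>c \<in> K\<close>] this[OF \<open>c + r *\<^sub>R b \<in> K\<close>] show False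
      using r b by (auto simp: nonzero_Basis add_eq_0_iff)
  qed
  with \<rho> have \<rho>: "\<rho> > 0" by simp
  have "K \<subseteq> (\<lambda>x. (T v - u) + T x) ` cball 0 1"
  proof
    fix x assume "x \<in> K"
    then obtain e where "e \<in> cball 0 1" "x + u = T (e + v)" using o by blast
    then show "x \<in> (\<lambda>x. (T v - u) + T x) ` cball 0 1"
      by (intro image_eqI[of _ _ e]) (auto simp: linear_add[OF T(1)] algebra_simps)
  qed
  moreover have "(\<lambda>x. ((1 / \<rho>) *\<^sub>R T v - u) + (1 / \<rho>) *\<^sub>R T x) ` cball 0 1 \<subseteq> K"
  proof clarify
    fix e :: 'a assume "e \<in> cball 0 1"
    then have "T (e + v) \<in> (\<lambda>x. \<rho> *\<^sub>R x) ` ((\<lambda>x. x + u) ` K)" using i by blast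
    then obtain x where x: "x \<in> K" "T e + T v = \<rho> *\<^sub>R (x + u)" by (auto simp: linear_add[OF T(1)])
    have "x = (1 / \<rho>) *\<^sub>R (T e + T v) - u" using \<rho> unfolding x(2) by simp
    then have "x = ((1 / \<rho>) *\<^sub>R T v - u) + (1 / \<rho>) *\<^sub>R T e"
      by (simp add: scaleR_add_right)
    then show "((1 / \<rho>) *\<^sub>R T v - u) + (1 / \<rho>) *\<^sub>R T e \<in> K"
      using x(1) by simp
  qed
  ultimately have "(1 / \<rho>) * R \<le> r"
    by (rule contact_decomposition_ellipsoid_ratio[OF K r R sub dec T, rotated 1]) (use \<rho> in simp)
  then show ?case using \<rho> r by (simp add: field_simps)
qed

section \<open>Moving the ellipsoids when the contact points fail to balance\<close>

text \<open>The compactness argument behind the perturbation: a function \<open>p \<le> 0\<close> becomes negative on all of \<open>X\<close>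
  as soon as its first-order change is negative at its zeros.\<close>

lemma small_perturbation_negative:
  fixes p q s :: "'a::topological_space \<Rightarrow> real"
  assumes X: "compact X" and cont: "continuous_on X p" "continuous_on X q" "continuous_on X s"
    and p: "\<And>x. x \<in> X \<Longrightarrow> p x \<le> 0" and q: "\<And>x. x \<in> X \<Longrightarrow> p x = 0 \<Longrightarrow> q x < 0"
  shows "\<forall>\<^sub>F t in at_right 0. \<forall>x\<in>X. p x + 2 * t * q x + t\<^sup>2 * s x < 0"
proof (cases "X = {}")
  case True
  then show ?thesis by simp
next
  case False
  \<comment> \<open>At every point of \<open>X\<close> either \<open>p\<close> or \<open>q\<close> is negative, hence one of them is at most \<open>-e\<close>.\<close>
  obtain x0 where x0: "x0 \<in> X" "\<And>x. x \<in> X \<Longrightarrow> min (p x) (q x) \<le> min (p x0) (q x0)"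
    using continuous_attains_sup[OF X False continuous_on_min[OF cont(1,2)]] by auto
  define e where "e = - min (p x0) (q x0)"
  have e: "e > 0" using p[OF x0(1)] q[OF x0(1)] by (auto simp: e_def min_def less_le)
  have pq: "p x \<le> - e \<or> q x \<le> - e" if "x \<in> X" for x
    using x0(2)[OF that] by (auto simp: e_def min_def split: if_splits)
  obtain xq where xq: "\<And>x. x \<in> X \<Longrightarrow> q x \<le> q xq"
    using continuous_attains_sup[OF X False cont(2)] by auto
  obtain xs where xs: "\<And>x. x \<in> X \<Longrightarrow> s x \<le> s xs"
    using continuous_attains_sup[OF X False cont(3)] by auto
  define B where "B = max 0 (max (q xq) (s xs))"
  have B: "B \<ge> 0" and qB: "\<And>x. x \<in> X \<Longrightarrow> q x \<le> B" and sB: "\<And>x. x \<in> X \<Longrightarrow> s x \<le> B"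
    using xq xs by (force simp: B_def)+
  have small: "p x + 2 * t * q x + t\<^sup>2 * s x < 0"
    if t: "0 < t" "t < min 1 (e / (3 * B + 1))" and x: "x \<in> X" for t x
  proof -
    have tB: "3 * (t * B) < e"
    proof -
      have "t * (3 * B + 1) < e" using t B by (simp add: field_simps)
      then show ?thesis using t(1) by (simp add: algebra_simps)
    qed
    have "t\<^sup>2 \<le> t" using t by (simp add: power2_eq_square)
    have sq: "t\<^sup>2 * s x \<le> t\<^sup>2 * B" "t\<^sup>2 * B \<le> t * B"
      using sB[OF x] B \<open>t\<^sup>2 \<le> t\<close> by (auto intro: mult_left_mono mult_right_mono)
    from pq[OF x] show ?thesis
    proof
      assume "p x \<le> - e"
      moreover have "t * q x \<le> t * B" using qB[OF x] t by simp
      ultimately show ?thesis using sq tB by linarith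
    next
      assume "q x \<le> - e"
      then have "t * (2 * q x + t * s x) < t * 0"
        using t(1) tB e mult_left_mono[OF sB[OF x], of t]
        by (intro mult_strict_left_mono) linarith+
      then show ?thesis using p[OF x] by (simp add: power2_eq_square algebra_simps)
    qed
  qed
  have "min 1 (e / (3 * B + 1)) > 0" using e B by simp
  then have "\<forall>\<^sub>F t in at_right 0. t \<in> {0<..<min 1 (e / (3 * B + 1))}"
    by (rule eventually_at_right_real)
  then show ?thesis by eventually_elim (use small in auto)
qed

lemma bij_identity_plus_small:
  fixes A :: "'a::euclidean_space \<Rightarrow> 'a"
  assumes A: "linear A"
  shows "\<forall>\<^sub>F t in at_right 0. bij (\<lambda>x. x + t *\<^sub>R A x)"
proof -
  obtain B where B: "B > 0" "\<And>x. norm (A x) \<le> B * norm x"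
    using linear_bounded_pos[OF A] by blast
  have "bij (\<lambda>x. x + t *\<^sub>R A x)" if t: "0 < t" "t < 1 / B" for t
  proof -
    have lin: "linear (\<lambda>x. x + t *\<^sub>R A x)"
      using A by (intro linear_compose_add linear_ident linear_compose_scale_right)
    have "x = 0" if "x + t *\<^sub>R A x = 0" for x
    proof (rule ccontr)
      assume "x \<noteq> 0"
      have "norm x = t * norm (A x)"
        using that t by (metis abs_of_pos add_eq_0_iff2 norm_minus_cancel norm_scaleR)
      also have "\<dots> \<le> t * (B * norm x)" using B t by simp
      also have "\<dots> < norm x" using t B(1) \<open>x \<noteq> 0\<close> by (simp add: field_simps)
      finally show False by simp
    qed
    then have "inj (\<lambda>x. x + t *\<^sub>R A x)" using linear_injective_0[OF lin] by blast
    with linear_inj_imp_surj[OF lin] show ?thesis by (simp add: bij_def)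
  qed
  moreover have "\<forall>\<^sub>F t in at_right 0. t \<in> {0<..<1 / B}"
    using B(1) by (intro eventually_at_right_real) simp
  ultimately show ?thesis by (auto elim: eventually_mono)
qed

text \<open>For \<open>F x = x + t *\<^sub>R A x\<close>, the new ellipsoids are the sets
  \<open>norm (F (x - d) + t *\<^sub>R w) \<le> R\<close> and \<open>norm (F (x - c) + t *\<^sub>R v) \<le> r\<close>. The derivative in \<open>t\<close> at \<open>0\<close>
  of each squared norm is twice the form whose sign is assumed at the contact points, so the outer
  norm decreases and the inner one increases exactly where there was no room. On the outer side
  strict inequality on the compact set \<open>K\<close> leaves room for the smaller radius \<open>R'\<close>.\<close>

lemma improved_ellipsoids:
  fixes K :: "'a::euclidean_space set" and A :: "'a \<Rightarrow> 'a"
  assumes K: "compact K" and r: "r > 0" and R: "R > 0"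
    and sub: "cball c r \<subseteq> K" and sup: "K \<subseteq> cball d R" and A: "linear A"
    and inner: "\<And>y. y \<in> contact_points K c r \<Longrightarrow> (y - c) \<bullet> (A (y - c) + v) > 0"
    and outer: "\<And>z. z \<in> contact_points K d R \<Longrightarrow> (z - d) \<bullet> (A (z - d) + w) < 0"
  obtains T :: "'a \<Rightarrow> 'a" and a b R' where "linear T" "bij T" "0 < R'" "R' < R"
    "K \<subseteq> (\<lambda>x. a + R' *\<^sub>R T x) ` cball 0 1" "(\<lambda>x. b + r *\<^sub>R T x) ` cball 0 1 \<subseteq> K"
proof -
  have cA: "continuous_on X (\<lambda>x. A (f x))" if "continuous_on X f" for X and f :: "'a \<Rightarrow> 'a"
    using linear_continuous_on_compose[OF that A] .
  define F where "F t x = x + t *\<^sub>R A x" for t x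
  have nF: "(norm (F t x + t *\<^sub>R v))\<^sup>2
      = (norm x)\<^sup>2 + 2 * t * (x \<bullet> (A x + v)) + t\<^sup>2 * (norm (A x + v))\<^sup>2" for t x v
  proof -
    have "F t x + t *\<^sub>R v = x + t *\<^sub>R (A x + v)" by (simp add: F_def algebra_simps)
    moreover have "(norm (x + u))\<^sup>2 = (norm x)\<^sup>2 + 2 * (x \<bullet> u) + (norm u)\<^sup>2" for u
      by (simp add: power2_norm_eq_inner inner_add_left inner_add_right inner_commute)
    ultimately show ?thesis by (simp add: power_mult_distrib)
  qed
  have "\<forall>\<^sub>F t in at_right 0. \<forall>x\<in>K. ((norm (x - d))\<^sup>2 - R\<^sup>2) + 2 * t * ((x - d) \<bullet> (A (x - d) + w))
      + t\<^sup>2 * (norm (A (x - d) + w))\<^sup>2 < 0"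
  proof (rule small_perturbation_negative[OF K])
    fix x assume x: "x \<in> K"
    then have n: "norm (x - d) \<le> R" using sup by (auto simp: dist_norm norm_minus_commute)
    then show "(norm (x - d))\<^sup>2 - R\<^sup>2 \<le> 0" by (simp add: power_mono)
    assume "(norm (x - d))\<^sup>2 - R\<^sup>2 = 0"
    then have n: "norm (x - d) = R" using R by (simp add: power2_eq_iff_nonneg)
    have "x \<notin> interior K"
    proof
      assume "x \<in> interior K"
      then have "x \<in> interior (cball d R)" using interior_mono[OF sup] by blast
      then show False using n by (simp add: dist_norm norm_minus_commute)
    qed
    then have "x \<in> contact_points K d R"
      using x n closure_subset[of K]
      by (auto simp: contact_points_def frontier_cball frontier_def dist_norm norm_minus_commute)
    then show "(x - d) \<bullet> (A (x - d) + w) < 0" by (rule outer)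
  qed (intro continuous_intros cA)+
  moreover have "\<forall>\<^sub>F t in at_right 0. \<forall>x\<in>frontier K. (r\<^sup>2 - (norm (x - c))\<^sup>2)
      + 2 * t * (- ((x - c) \<bullet> (A (x - c) + v))) + t\<^sup>2 * (- (norm (A (x - c) + v))\<^sup>2) < 0"
  proof (rule small_perturbation_negative[OF compact_frontier[OF K]])
    fix x assume x: "x \<in> frontier K"
    have "ball c r \<subseteq> interior K" using interior_mono[OF sub] by simp
    then have "x \<notin> ball c r" using x by (auto simp: frontier_def)
    then have n: "r \<le> norm (x - c)" by (simp add: dist_norm norm_minus_commute)
    then show "r\<^sup>2 - (norm (x - c))\<^sup>2 \<le> 0" using r by (simp add: power_mono)
    assume "r\<^sup>2 - (norm (x - c))\<^sup>2 = 0"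
    then have n: "norm (x - c) = r" using r by (simp add: power2_eq_iff_nonneg)
    then have "x \<in> contact_points K c r"
      using x by (auto simp: contact_points_def frontier_cball dist_norm norm_minus_commute)
    then show "- ((x - c) \<bullet> (A (x - c) + v)) < 0" using inner by simp
  qed (intro continuous_intros cA)+
  moreover have "\<forall>\<^sub>F t in at_right 0. bij (F t)"
    unfolding F_def by (rule bij_identity_plus_small[OF A])
  moreover have "\<forall>\<^sub>F t in at_right 0. t \<in> {0<..<r / (norm v + 1)}"
    using r by (intro eventually_at_right_real) (simp add: add_nonneg_pos)
  ultimately have "\<forall>\<^sub>F t in at_right 0. (\<forall>x\<in>K. norm (F t (x - d) + t *\<^sub>R w) < R)
      \<and> (\<forall>x\<in>frontier K. norm (F t (x - c) + t *\<^sub>R v) > r) \<and> bij (F t)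
      \<and> t \<in> {0<..<r / (norm v + 1)}"
  proof eventually_elim
    case (elim t)
    have "norm (F t (x - d) + t *\<^sub>R w) < R" if "x \<in> K" for x
    proof (rule power2_less_imp_less)
      show "(norm (F t (x - d) + t *\<^sub>R w))\<^sup>2 < R\<^sup>2" using elim(1) that unfolding nF by force
    qed (use R in simp)
    moreover have "norm (F t (x - c) + t *\<^sub>R v) > r" if "x \<in> frontier K" for x
    proof (rule power2_less_imp_less)
      show "r\<^sup>2 < (norm (F t (x - c) + t *\<^sub>R v))\<^sup>2" using elim(2) that unfolding nF by force
    qed simp
    ultimately show ?case using elim by blast
  qed
  then obtain t where out: "\<And>x. x \<in> K \<Longrightarrow> norm (F t (x - d) + t *\<^sub>R w) < R"
    and inn: "\<And>x. x \<in> frontier K \<Longrightarrow> norm (F t (x - c) + t *\<^sub>R v) > r"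
    and bijF: "bij (F t)" and t: "0 < t" "t < r / (norm v + 1)"
    using eventually_happens'[OF trivial_limit_at_right_real] by force
  have linF: "linear (F t)"
    unfolding F_def using A by (intro linear_compose_add linear_ident linear_compose_scale_right)
  define T where "T = inv (F t)"
  have T: "linear T" unfolding T_def using inj_linear_imp_inv_linear[OF linF] bijF by (simp add: bij_is_inj)
  have FT: "F t (T x) = x" and TF: "T (F t x) = x" for x
    unfolding T_def using bijF by (auto simp: bij_is_inj bij_is_surj surj_f_inv_f)
  have bijT: "bij T" unfolding T_def using bijF by (rule bij_imp_bij_inv)
  have c: "c \<in> K" using sub r by auto
  \<comment> \<open>Compactness turns the strict outer inclusion into one with a smaller radius.\<close>
  have "continuous_on K (\<lambda>x. norm (F t (x - d) + t *\<^sub>R w))"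
    unfolding F_def by (intro continuous_intros cA)
  then obtain x0 where x0: "x0 \<in> K" "\<And>x. x \<in> K \<Longrightarrow>
      norm (F t (x - d) + t *\<^sub>R w) \<le> norm (F t (x0 - d) + t *\<^sub>R w)"
    using continuous_attains_sup[OF K] c by blast
  define R' where "R' = (norm (F t (x0 - d) + t *\<^sub>R w) + R) / 2"
  have R': "0 < R'" "R' < R" using out[OF x0(1)] R by (auto simp: R'_def add_nonneg_pos)
  have R'_bd: "norm (F t (x - d) + t *\<^sub>R w) \<le> R'" if "x \<in> K" for x
    using x0(2)[OF that] out[OF x0(1)] by (simp add: R'_def)
  have "K \<subseteq> (\<lambda>x. (d - T (t *\<^sub>R w)) + R' *\<^sub>R T x) ` cball 0 1"
  proof
    fix x assume x: "x \<in> K"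
    define e where "e = (1 / R') *\<^sub>R (F t (x - d) + t *\<^sub>R w)"
    have "norm e \<le> 1" using R'_bd[OF x] R' by (simp add: e_def)
    moreover have "(d - T (t *\<^sub>R w)) + R' *\<^sub>R T e = x"
    proof -
      have "R' *\<^sub>R T e = T (F t (x - d)) + T (t *\<^sub>R w)"
        using R' by (simp add: e_def linear_cmul[OF T] linear_add[OF T])
      then show ?thesis by (simp add: TF)
    qed
    ultimately show "x \<in> (\<lambda>x. (d - T (t *\<^sub>R w)) + R' *\<^sub>R T x) ` cball 0 1"
      by (intro image_eqI[of _ _ e]) auto
  qed
  \<comment> \<open>The inner ellipsoid is connected, contains \<open>c\<close> and avoids the frontier of \<open>K\<close>.\<close>
  moreover have "(\<lambda>x. (c - T (t *\<^sub>R v)) + r *\<^sub>R T x) ` cball 0 1 \<subseteq> K"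
  proof -
    define G where "G = (\<lambda>x. (c - T (t *\<^sub>R v)) + r *\<^sub>R T x) ` cball 0 1"
    have cT: "continuous_on X T" for X using T by (rule linear_continuous_on_compose[OF continuous_on_id])
    have conn: "connected G"
      unfolding G_def by (intro connected_continuous_image continuous_intros cT)
        (simp add: convex_connected)
    have "c \<in> G" unfolding G_def
    proof (rule image_eqI)
      show "c = (c - T (t *\<^sub>R v)) + r *\<^sub>R T ((t / r) *\<^sub>R v)" using r by (simp add: linear_cmul[OF T])
      have "t * (norm v + 1) < r" using t(2) by (simp add: pos_less_divide_eq add_nonneg_pos)
      then have "t * norm v \<le> r" using t(1) by (simp add: algebra_simps)
      then show "(t / r) *\<^sub>R v \<in> cball 0 1" using t r by simp
    qed
    moreover have "G \<inter> frontier K = {}"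
    proof -
      have "norm (F t (x - c) + t *\<^sub>R v) \<le> r" if x: "x \<in> G" for x
      proof -
        obtain e where e: "norm e \<le> 1" "x = (c - T (t *\<^sub>R v)) + r *\<^sub>R T e"
          using x by (auto simp: G_def)
        have "F t (x - c) + t *\<^sub>R v = r *\<^sub>R e"
          by (simp add: e(2) linear_add[OF linF] linear_diff[OF linF] linear_cmul[OF linF]
              linear_neg[OF linF] FT)
        then show ?thesis using e(1) r by simp
      qed
      then show ?thesis using inn by force
    qed
    ultimately show ?thesis using connected_Int_frontier[OF conn, of K] c unfolding G_def by blast
  qed
  ultimately show ?thesis using that[OF T bijT R'] by blast
qed

lemma compact_contact_points: "compact (contact_points K p s)"
  for K :: "'a::euclidean_space set"
  unfolding contact_points_def
  by (intro closed_Int_compact compact_frontier compact_cball) simp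

lemma compact_strict_separation:
  fixes f g :: "'a::topological_space \<Rightarrow> real"
  assumes "compact S" "compact T" "continuous_on S f" "continuous_on T g"
    and less: "\<And>x y. x \<in> S \<Longrightarrow> y \<in> T \<Longrightarrow> g y < f x"
  obtains \<alpha> where "\<And>x. x \<in> S \<Longrightarrow> \<alpha> < f x" "\<And>y. y \<in> T \<Longrightarrow> g y < \<alpha>"
proof -
  have S: "\<exists>x\<in>S. \<forall>y\<in>S. f x \<le> f y" if "S \<noteq> {}"
    using continuous_attains_inf[OF assms(1) that assms(3)] .
  have T: "\<exists>x\<in>T. \<forall>y\<in>T. g y \<le> g x" if "T \<noteq> {}"
    using continuous_attains_sup[OF assms(2) that assms(4)] .
  consider "S = {}" "T = {}" | x where "x \<in> S" "\<forall>y\<in>S. f x \<le> f y" "T = {}"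
    | z where "z \<in> T" "\<forall>y\<in>T. g y \<le> g z" "S = {}"
    | x z where "x \<in> S" "\<forall>y\<in>S. f x \<le> f y" "z \<in> T" "\<forall>y\<in>T. g y \<le> g z"
    using S T by metis
  then show ?thesis
  proof cases
    case 1
    then show ?thesis using that by blast
  next
    case 2
    then show ?thesis using that[of "f x - 1"] by force
  next
    case 3
    then show ?thesis using that[of "g z + 1"] by force
  next
    case 4
    then show ?thesis
      using that[of "(f x + g z) / 2"] less[of x z] by force
  qed
qed

text \<open>The perturbation needs both forms to be separated by zero. The gap between them is shifted to
  zero by changing \<open>A\<close>, which is harmless because contact directions are unit vectors.\<close>

lemma unbalanced_contacts_imp_dist_less:
  fixes K :: "'a::euclidean_space set" and A :: "'a \<Rightarrow> 'a"
  assumes K: "compact K" and r: "r > 0" and R: "R > 0"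
    and sub: "cball c r \<subseteq> K" and sup: "K \<subseteq> cball d R" and A: "linear A"
    and less: "\<And>y z. y \<in> contact_points K c r \<Longrightarrow> z \<in> contact_points K d R \<Longrightarrow>
      ((z - d) /\<^sub>R R) \<bullet> (A ((z - d) /\<^sub>R R) + w) < ((y - c) /\<^sub>R r) \<bullet> (A ((y - c) /\<^sub>R r) + v)"
  shows "banach_mazur_dist K (cball 0 1) < R / r"
proof -
  have cA: "continuous_on X (\<lambda>x. A (f x))" if "continuous_on X f" for X and f :: "'a \<Rightarrow> 'a"
    using linear_continuous_on_compose[OF that A] .
  obtain \<alpha> where \<alpha>: "\<And>y. y \<in> contact_points K c r \<Longrightarrow>
        \<alpha> < ((y - c) /\<^sub>R r) \<bullet> (A ((y - c) /\<^sub>R r) + v)"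
      "\<And>z. z \<in> contact_points K d R \<Longrightarrow> ((z - d) /\<^sub>R R) \<bullet> (A ((z - d) /\<^sub>R R) + w) < \<alpha>"
    by (rule compact_strict_separation[of "contact_points K c r" "contact_points K d R"
          "\<lambda>y. ((y - c) /\<^sub>R r) \<bullet> (A ((y - c) /\<^sub>R r) + v)"
          "\<lambda>z. ((z - d) /\<^sub>R R) \<bullet> (A ((z - d) /\<^sub>R R) + w)"])
      (use less in \<open>auto intro!: continuous_intros cA compact_contact_points\<close>)
  \<comment> \<open>On unit vectors, subtracting \<open>\<alpha>\<close> times the identity shifts both quadratic forms by \<open>\<alpha>\<close>.\<close>
  define B where "B = (\<lambda>x. A x - \<alpha> *\<^sub>R x)"
  have B: "linear B" unfolding B_def
    using A by (intro linear_compose_sub linear_compose_scale_right linear_ident)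
  have scale: "(p - e) \<bullet> (B (p - e) + s *\<^sub>R u)
      = s\<^sup>2 * (((p - e) /\<^sub>R s) \<bullet> (A ((p - e) /\<^sub>R s) + u) - \<alpha>)"
    if "p \<in> contact_points K e s" "s > 0" for p e s u
  proof -
    define q where "q = (p - e) /\<^sub>R s"
    have "norm (p - e) = s"
      using that by (auto simp: contact_points_def frontier_cball dist_norm norm_minus_commute)
    then have "q \<bullet> q = 1" and pq: "p - e = s *\<^sub>R q"
      using that(2) by (auto simp: q_def dot_square_norm)
    then show ?thesis
      unfolding q_def[symmetric] unfolding pq
      by (simp add: B_def linear_cmul[OF A] inner_add_right inner_diff_right power2_eq_square
          algebra_simps)
  qed
  have "(y - c) \<bullet> (B (y - c) + r *\<^sub>R v) > 0" if "y \<in> contact_points K c r" for y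
    using \<alpha>(1)[OF that] r by (simp add: scale[OF that r])
  moreover have "(z - d) \<bullet> (B (z - d) + R *\<^sub>R w) < 0" if "z \<in> contact_points K d R" for z
    using \<alpha>(2)[OF that] R unfolding scale[OF that R] by (intro mult_pos_neg) auto
  ultimately obtain T :: "'a \<Rightarrow> 'a" and a b R' where T: "linear T" "bij T" and R': "0 < R'" "R' < R"
    and "K \<subseteq> (\<lambda>x. a + R' *\<^sub>R T x) ` cball 0 1" "(\<lambda>x. b + r *\<^sub>R T x) ` cball 0 1 \<subseteq> K"
    by (rule improved_ellipsoids[OF K r R sub sup B]) blast+
  then have "banach_mazur_dist K (cball 0 1) \<le> R' / r"
    by (intro banach_mazur_dist_ball_le(1)[OF T r R'(1)])
  also have "\<dots> < R / r" using R' r by (simp add: divide_strict_right_mono)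
  finally show ?thesis .
qed

section \<open>Separation and a short decomposition\<close>

definition outer_product :: "real ^ 'n \<Rightarrow> real ^ 'n ^ 'n" where
  "outer_product x = (\<chi> i j. x $ i * x $ j)"

lemma inner_outer_product: "B \<bullet> outer_product x = x \<bullet> (B *v x)"
  by (simp add: outer_product_def inner_vec_def matrix_vector_mult_def sum_distrib_left
      mult_ac)

lemma outer_product_mult_vec: "outer_product x *v u = (u \<bullet> x) *\<^sub>R x"
  by (simp add: outer_product_def vec_eq_iff matrix_vector_mult_def inner_vec_def
      sum_distrib_left mult_ac)

text \<open>Separation of matrices produces an arbitrary matrix, whereas the balance condition concerns
  symmetric ones.\<close>

lemma inner_symmetrized:
  fixes B :: "real ^ 'n ^ 'n"
  shows "x \<bullet> (((1 / 2) *\<^sub>R (B + transpose B)) *v x) = x \<bullet> (B *v x)"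
proof -
  have "x \<bullet> (transpose B *v x) = x \<bullet> (B *v x)"
    by (metis dot_lmul_matrix inner_commute transpose_matrix_vector)
  then show ?thesis
    by (simp add: scaleR_matrix_vector_assoc[symmetric] matrix_vector_mult_add_rdistrib
        inner_add_right)
qed

text \<open>A symmetric matrix is determined by its entries on unordered pairs of indices, that is, on index
  sets with one or two elements; this needs no order on the index type.\<close>

lemma dim_symmetric_matrices:
  "2 * dim {B :: real ^ 'n ^ 'n. transpose B = B} \<le> CARD('n) * (CARD('n) + 1)"
proof -
  define I where "I = {P :: 'n set. card P = 1 \<or> card P = 2}"
  define E :: "'n set \<Rightarrow> real ^ 'n ^ 'n" where "E P = (\<chi> i j. if {i, j} = P then 1 else 0)" for P
  have "{B :: real ^ 'n ^ 'n. transpose B = B} \<subseteq> span (E ` I)"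
  proof clarify
    fix B :: "real ^ 'n ^ 'n" assume sym: "transpose B = B"
    have sym: "B $ i $ j = B $ j $ i" for i j
      using arg_cong[OF sym, of "\<lambda>M. M $ i $ j"] by (simp add: transpose_def)
    \<comment> \<open>The common value of \<open>B $ i $ j\<close> and \<open>B $ j $ i\<close> as a function of the set \<open>{i, j}\<close>.\<close>
    define e where "e P = (SOME b. \<exists>i j. P = {i, j} \<and> b = B $ i $ j)" for P
    have e: "e {i, j} = B $ i $ j" for i j
      unfolding e_def by (rule some_equality) (auto simp: doubleton_eq_iff sym)
    have "B = (\<Sum>P\<in>I. e P *\<^sub>R E P)"
    proof (simp only: vec_eq_iff, intro allI)
      fix i j
      have I: "{i, j} \<in> I" by (cases "i = j") (auto simp: I_def)
      have "(\<Sum>P\<in>I. e P *\<^sub>R E P) $ i $ j = (\<Sum>P\<in>I. e P * (if {i, j} = P then 1 else 0))"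
        by (simp add: E_def)
      also have "\<dots> = (\<Sum>P\<in>I. if P = {i, j} then e P else 0)"
        by (intro sum.cong) auto
      also have "\<dots> = e {i, j}" using I by (simp add: I_def)
      finally show "B $ i $ j = (\<Sum>P\<in>I. e P *\<^sub>R E P) $ i $ j" by (simp only: e)
    qed
    also have "\<dots> \<in> span (E ` I)" by (intro span_sum span_scale span_base) auto
    finally show "B \<in> span (E ` I)" .
  qed
  then have "dim {B :: real ^ 'n ^ 'n. transpose B = B} \<le> card (E ` I)" by (intro dim_le_card) auto
  also have "\<dots> \<le> card I" by (intro card_image_le) auto
  also have "card I = CARD('n) + (CARD('n) choose 2)"
  proof -
    have "card I = card {P :: 'n set. card P = 1} + card {P :: 'n set. card P = 2}"
      unfolding I_def Collect_disj_eq by (rule card_Un_disjoint) auto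
    then show ?thesis
      using n_subsets[of "UNIV :: 'n set" 1] n_subsets[of "UNIV :: 'n set" 2] by simp
  qed
  finally have "2 * dim {B :: real ^ 'n ^ 'n. transpose B = B}
      \<le> 2 * CARD('n) + CARD('n) * (CARD('n) - 1)"
    by (simp add: choose_two)
  also have "\<dots> = CARD('n) * (CARD('n) + 1)" by (cases "CARD('n)") auto
  finally show ?thesis .
qed

text \<open>The inner product with \<open>(A, v, w)\<close> turns these lifts into \<open>y \<bullet> (A *v y + v)\<close> for inner and
  \<open>- z \<bullet> (A *v z - w)\<close> for outer contact directions. The signs and the separate slots make a vanishing
  combination express equal second moments and two vanishing first moments.\<close>

definition inner_lift :: "real ^ 'n \<Rightarrow> (real ^ 'n ^ 'n) \<times> (real ^ 'n) \<times> (real ^ 'n)" where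
  "inner_lift x = (outer_product x, x, 0)"

definition outer_lift :: "real ^ 'n \<Rightarrow> (real ^ 'n ^ 'n) \<times> (real ^ 'n) \<times> (real ^ 'n)" where
  "outer_lift x = (- outer_product x, 0, x)"

lemma aff_dim_lifts:
  fixes Y Z :: "(real ^ 'n) set"
  shows "2 * aff_dim (inner_lift ` Y \<union> outer_lift ` Z) \<le> int (CARD('n) * (CARD('n) + 5))"
proof -
  define S where "S = {B :: real ^ 'n ^ 'n. transpose B = B}"
  have S: "subspace S"
    unfolding S_def by (auto simp: subspace_def transpose_def vec_eq_iff)
  have sub: "inner_lift ` Y \<union> outer_lift ` Z \<subseteq> S \<times> UNIV"
    by (auto simp: S_def inner_lift_def outer_lift_def outer_product_def transpose_def vec_eq_iff)
  have "aff_dim (inner_lift ` Y \<union> outer_lift ` Z)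
      \<le> aff_dim (S \<times> (UNIV :: ((real ^ 'n) \<times> (real ^ 'n)) set))"
    by (rule aff_dim_subset[OF sub])
  also have "\<dots> = int (dim (S \<times> (UNIV :: ((real ^ 'n) \<times> (real ^ 'n)) set)))"
    using S by (intro aff_dim_subspace subspace_Times) auto
  also have "\<dots> = int (dim S + 2 * CARD('n))"
    by (subst dim_Times[OF S subspace_UNIV]) simp
  finally show ?thesis
    using of_nat_mono[OF dim_symmetric_matrices[where 'n = 'n], where 'a = int] unfolding S_def
    by (simp add: algebra_simps)
qed

text \<open>If zero were outside the hull, a separating functional would make the first form positive on
  all of \<open>Y\<close> and the second negative on all of \<open>Z\<close>, contrary to the balance condition.\<close>

lemma zero_in_hull_of_lifts:
  fixes Y Z :: "(real ^ 'n) set"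
  assumes Y: "compact Y" and Z: "compact Z"
    and bal: "\<And>(A :: real ^ 'n ^ 'n) v w. transpose A = A \<Longrightarrow>
      \<exists>y\<in>Y. \<exists>z\<in>Z. y \<bullet> (A *v y + v) \<le> z \<bullet> (A *v z + w)"
  shows "0 \<in> convex hull (inner_lift ` Y \<union> outer_lift ` Z)"
proof (rule ccontr)
  assume n: "0 \<notin> convex hull (inner_lift ` Y \<union> outer_lift ` Z)"
  have cop: "continuous_on X (outer_product :: real ^ 'n \<Rightarrow> _)" for X
    unfolding outer_product_def by (intro continuous_intros)
  have "compact (inner_lift ` Y)" "compact (outer_lift ` Z)"
    unfolding inner_lift_def outer_lift_def
    by (intro compact_continuous_image continuous_intros cop Y Z)+
  then have "closed (convex hull (inner_lift ` Y \<union> outer_lift ` Z))"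
    by (intro compact_imp_closed compact_convex_hull compact_Un)
  from separating_hyperplane_closed_0[OF convex_convex_hull this n]
  obtain a b where "0 < b" "\<And>x. x \<in> convex hull (inner_lift ` Y \<union> outer_lift ` Z) \<Longrightarrow> b < a \<bullet> x"
    by blast
  then have a: "0 < a \<bullet> x" if "x \<in> inner_lift ` Y \<union> outer_lift ` Z" for x
    using hull_inc[OF that, of convex] by (meson less_trans)
  obtain B v w where B: "a = (B, v, w)" by (cases a)
  have y: "0 < y \<bullet> (B *v y) + y \<bullet> v" if "y \<in> Y" for y
    using a[of "inner_lift y"] that
    by (simp add: B inner_lift_def inner_outer_product inner_commute)
  have z: "z \<bullet> (B *v z) - z \<bullet> w < 0" if "z \<in> Z" for z
    using a[of "outer_lift z"] that
    by (simp add: B outer_lift_def inner_outer_product inner_commute)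
  define A where "A = (1 / 2) *\<^sub>R (B + transpose B)"
  have "transpose A = A" by (simp add: A_def transpose_def vec_eq_iff add.commute)
  from bal[OF this, of v "- w"] obtain y' z' where "y' \<in> Y" "z' \<in> Z"
    "y' \<bullet> (A *v y' + v) \<le> z' \<bullet> (A *v z' + - w)" by blast
  with y[of y'] z[of z'] show False
    by (simp add: inner_add_right inner_diff_right A_def inner_symmetrized)
qed

text \<open>Caratheodory's theorem is applied to inner and outer lifts together, so that it bounds the total
  number of points. Both kinds occur with positive weight because the traces of the two second
  moments agree.\<close>

lemma short_balanced_weights:
  fixes Y Z :: "(real ^ 'n) set"
  assumes zero: "0 \<in> convex hull (inner_lift ` Y \<union> outer_lift ` Z)"
    and Yn: "\<And>y. y \<in> Y \<Longrightarrow> norm y = 1" and Zn: "\<And>z. z \<in> Z \<Longrightarrow> norm z = 1"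
  obtains P Q f g where "finite P" "finite Q" "P \<subseteq> Y" "Q \<subseteq> Z" "P \<noteq> {}" "Q \<noteq> {}"
    "2 * (card P + card Q) \<le> CARD('n) * (CARD('n) + 5) + 2"
    "\<And>y. y \<in> P \<Longrightarrow> f y > 0" "\<And>z. z \<in> Q \<Longrightarrow> g z > 0"
    "\<And>u. (\<Sum>y\<in>P. f y *\<^sub>R ((u \<bullet> y) *\<^sub>R y)) = (\<Sum>z\<in>Q. g z *\<^sub>R ((u \<bullet> z) *\<^sub>R z))"
    "(\<Sum>y\<in>P. f y *\<^sub>R y) = 0" "(\<Sum>z\<in>Q. g z *\<^sub>R z) = 0"
proof -
  obtain S h where S: "finite S" "S \<subseteq> inner_lift ` Y \<union> outer_lift ` Z"
    and card: "int (card S) \<le> aff_dim (inner_lift ` Y \<union> outer_lift ` Z) + 1"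
    and h: "\<And>x. x \<in> S \<Longrightarrow> 0 \<le> h x" "sum h S = 1" "(\<Sum>x\<in>S. h x *\<^sub>R x) = 0"
    using zero unfolding convex_hull_caratheodory_aff_dim by blast
  define S' where "S' = {x \<in> S. h x > 0}"
  have S': "finite S'" "S' \<subseteq> S" using S by (auto simp: S'_def)
  define P where "P = {y \<in> Y. inner_lift y \<in> S'}"
  define Q where "Q = {z \<in> Z. outer_lift z \<in> S'}"
  have inj: "inj_on inner_lift X" "inj_on outer_lift X" for X :: "(real ^ 'n) set"
    by (auto simp: inj_on_def inner_lift_def outer_lift_def)
  have dec: "S' = inner_lift ` P \<union> outer_lift ` Q"
    using S(2) S'(2) by (auto simp: P_def Q_def)
  have disj: "inner_lift ` P \<inter> outer_lift ` Q = {}"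
    using Yn by (force simp: P_def inner_lift_def outer_lift_def)
  have fin: "finite P" "finite Q"
    using S'(1) unfolding dec by (auto dest: finite_imageD[OF _ inj(1)] finite_imageD[OF _ inj(2)])
  have split: "(\<Sum>x\<in>S'. k x) = (\<Sum>y\<in>P. k (inner_lift y)) + (\<Sum>z\<in>Q. k (outer_lift z))"
    for k :: "_ \<Rightarrow> 'b::comm_monoid_add"
    unfolding dec using fin disj by (simp add: sum.union_disjoint sum.reindex inj)
  define f where "f y = h (inner_lift y)" for y
  define g where "g z = h (outer_lift z)" for z
  have h0: "h x = 0" if "x \<in> S - S'" for x using that h(1)[of x] by (simp add: S'_def)
  have "(\<Sum>x\<in>S'. h x) = 1" "(\<Sum>x\<in>S'. h x *\<^sub>R x) = 0"
    unfolding h(2,3)[symmetric] by (rule sum.mono_neutral_left[OF S(1) S'(2)]; simp add: h0)+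
  then have total: "sum f P + sum g Q = 1"
    and lifted: "(\<Sum>y\<in>P. f y *\<^sub>R inner_lift y) + (\<Sum>z\<in>Q. g z *\<^sub>R outer_lift z) = 0"
    by (simp_all add: split f_def g_def)
  have lin1: "(\<Sum>y\<in>P. f y *\<^sub>R y) = 0" and lin2: "(\<Sum>z\<in>Q. g z *\<^sub>R z) = 0"
    and mat: "(\<Sum>y\<in>P. f y *\<^sub>R outer_product y) = (\<Sum>z\<in>Q. g z *\<^sub>R outer_product z)"
    using lifted
    by (simp_all add: inner_lift_def outer_lift_def prod_eq_iff fst_sum snd_sum sum_negf)
  have quad: "(\<Sum>y\<in>P. f y *\<^sub>R ((u \<bullet> y) *\<^sub>R y)) = (\<Sum>z\<in>Q. g z *\<^sub>R ((u \<bullet> z) *\<^sub>R z))" for u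
  proof -
    have lin: "linear (\<lambda>M :: real ^ 'n ^ 'n. M *v u)"
      by (auto intro!: linearI simp: matrix_vector_mult_add_rdistrib scaleR_matrix_vector_assoc)
    from arg_cong[OF mat, of "\<lambda>M. M *v u"] show ?thesis
      by (simp add: linear_sum[OF lin] linear_cmul[OF lin] outer_product_mult_vec)
  qed
  \<comment> \<open>Pairing with the identity matrix reads off the total weights.\<close>
  have "sum f P = sum g Q"
  proof -
    have tr: "mat 1 \<bullet> outer_product x = (norm x)\<^sup>2" for x :: "real ^ 'n"
      by (simp add: inner_outer_product power2_norm_eq_inner)
    from arg_cong[OF mat, of "inner (mat 1)"]
    have "(\<Sum>y\<in>P. f y * (norm y)\<^sup>2) = (\<Sum>z\<in>Q. g z * (norm z)\<^sup>2)"
      by (simp add: inner_sum_right tr)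
    moreover have "(\<Sum>y\<in>P. f y * (norm y)\<^sup>2) = sum f P" "(\<Sum>z\<in>Q. g z * (norm z)\<^sup>2) = sum g Q"
      using Yn Zn by (auto simp: P_def Q_def intro!: sum.cong)
    ultimately show ?thesis by simp
  qed
  then have "P \<noteq> {}" "Q \<noteq> {}" using total by auto
  moreover have "2 * (card P + card Q) \<le> CARD('n) * (CARD('n) + 5) + 2"
  proof -
    define k where "k = CARD('n) * (CARD('n) + 5)"
    have "card P + card Q = card S'"
      unfolding dec using fin disj by (simp add: card_Un_disjoint card_image inj)
    also have "\<dots> \<le> card S" using S S' by (intro card_mono) auto
    finally have "int (card P + card Q) \<le> int (card S)" by (simp only: of_nat_le_iff)
    also have "\<dots> \<le> aff_dim (inner_lift ` Y \<union> outer_lift ` Z) + 1" by (rule card)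
    finally have "2 * int (card P + card Q) \<le> 2 * aff_dim (inner_lift ` Y \<union> outer_lift ` Z) + 2"
      by simp
    also have "\<dots> \<le> int k + 2" using aff_dim_lifts[of Y Z] unfolding k_def by simp
    finally have "int (2 * (card P + card Q)) \<le> int (k + 2)" by simp
    then show ?thesis unfolding k_def of_nat_le_iff .
  qed
  moreover have "\<And>y. y \<in> P \<Longrightarrow> f y > 0" "\<And>z. z \<in> Q \<Longrightarrow> g z > 0" "P \<subseteq> Y" "Q \<subseteq> Z"
    by (auto simp: P_def Q_def S'_def f_def g_def)
  ultimately show ?thesis using that[OF fin _ _ _ _ _ _ _ quad lin1 lin2] by blast
qed

text \<open>Passing from unit contact directions back to contact points multiplies second moments by \<open>r\<^sup>2\<close>
  and \<open>R\<^sup>2\<close>, which the weights have to compensate.\<close>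

lemma short_contact_decomposition:
  fixes K :: "(real ^ 'n) set"
  assumes r: "r > 0" and R: "R > 0"
    and bal: "\<And>(A :: real ^ 'n ^ 'n) v w. transpose A = A \<Longrightarrow>
      \<exists>y \<in> contact_points K c r. \<exists>z \<in> contact_points K d R.
        ((y - c) /\<^sub>R r) \<bullet> (A *v ((y - c) /\<^sub>R r) + v) \<le> ((z - d) /\<^sub>R R) \<bullet> (A *v ((z - d) /\<^sub>R R) + w)"
  shows "\<exists>N M y z lam mu. contact_decomposition K c r d R N M y z lam mu \<and>
    real (N + M) \<le> real CARD('n) * (real CARD('n) + 5) / 2 + 1"
proof -
  define Y where "Y = (\<lambda>y. (y - c) /\<^sub>R r) ` contact_points K c r"
  define Z where "Z = (\<lambda>z. (z - d) /\<^sub>R R) ` contact_points K d R"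
  have comp: "compact Y" "compact Z"
    unfolding Y_def Z_def
    by (intro compact_continuous_image continuous_intros compact_contact_points)+
  have "0 \<in> convex hull (inner_lift ` Y \<union> outer_lift ` Z)"
    using bal unfolding Y_def Z_def by (intro zero_in_hull_of_lifts comp[unfolded Y_def Z_def]) simp
  moreover have "\<And>y. y \<in> Y \<Longrightarrow> norm y = 1" "\<And>z. z \<in> Z \<Longrightarrow> norm z = 1"
    using r R by (auto simp: Y_def Z_def contact_points_def frontier_cball dist_norm norm_minus_commute)
  ultimately obtain P Q f g where PQ: "finite P" "finite Q" "P \<subseteq> Y" "Q \<subseteq> Z" "P \<noteq> {}" "Q \<noteq> {}"
    and card: "2 * (card P + card Q) \<le> CARD('n) * (CARD('n) + 5) + 2"
    and pos: "\<And>y. y \<in> P \<Longrightarrow> f y > 0" "\<And>z. z \<in> Q \<Longrightarrow> g z > 0"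
    and quad: "\<And>u. (\<Sum>y\<in>P. f y *\<^sub>R ((u \<bullet> y) *\<^sub>R y)) = (\<Sum>z\<in>Q. g z *\<^sub>R ((u \<bullet> z) *\<^sub>R z))"
    and lin: "(\<Sum>y\<in>P. f y *\<^sub>R y) = 0" "(\<Sum>z\<in>Q. g z *\<^sub>R z) = 0"
    by (rule short_balanced_weights) blast+
  obtain p where p: "bij_betw p {1..card P} P" using ex_bij_betw_nat_finite_1[OF PQ(1)] by blast
  obtain q where q: "bij_betw q {1..card Q} Q" using ex_bij_betw_nat_finite_1[OF PQ(2)] by blast
  define y where "y i = c + r *\<^sub>R p i" for i
  define z where "z j = d + R *\<^sub>R q j" for j
  define lam where "lam i = f (p i) / r\<^sup>2" for i
  define mu where "mu j = g (q j) / R\<^sup>2" for j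
  have pin: "p i \<in> P" if "i \<in> {1..card P}" for i using p that by (rule bij_betwE[rule_format])
  have qin: "q j \<in> Q" if "j \<in> {1..card Q}" for j using q that by (rule bij_betwE[rule_format])
  have yc: "y i \<in> contact_points K c r" if "i \<in> {1..card P}" for i
    using pin[OF that] PQ(3) r by (auto simp: y_def Y_def)
  have zc: "z j \<in> contact_points K d R" if "j \<in> {1..card Q}" for j
    using qin[OF that] PQ(4) R by (auto simp: z_def Z_def)
  have sums: "(\<Sum>i=1..card P. k (p i)) = (\<Sum>x\<in>P. k x)" "(\<Sum>j=1..card Q. k (q j)) = (\<Sum>x\<in>Q. k x)"
    for k :: "real ^ 'n \<Rightarrow> real ^ 'n"
    using p q by (auto intro: sum.reindex_bij_betw)
  have "(\<Sum>i=1..card P. lam i *\<^sub>R ((x \<bullet> (y i - c)) *\<^sub>R (y i - c)))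
      = (\<Sum>j=1..card Q. mu j *\<^sub>R ((x \<bullet> (z j - d)) *\<^sub>R (z j - d)))" for x
  proof -
    have "lam i *\<^sub>R ((x \<bullet> (y i - c)) *\<^sub>R (y i - c)) = f (p i) *\<^sub>R ((x \<bullet> p i) *\<^sub>R p i)" for i
      using r by (simp add: lam_def y_def power2_eq_square)
    moreover have "mu j *\<^sub>R ((x \<bullet> (z j - d)) *\<^sub>R (z j - d)) = g (q j) *\<^sub>R ((x \<bullet> q j) *\<^sub>R q j)" for j
      using R by (simp add: mu_def z_def power2_eq_square)
    ultimately show ?thesis
      using quad[of x] by (simp only: sums(1)[of "\<lambda>y. f y *\<^sub>R ((x \<bullet> y) *\<^sub>R y)"]
          sums(2)[of "\<lambda>z. g z *\<^sub>R ((x \<bullet> z) *\<^sub>R z)"])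
  qed
  moreover have "(\<Sum>i=1..card P. lam i *\<^sub>R (y i - c)) = 0"
  proof -
    have "(\<Sum>i=1..card P. lam i *\<^sub>R (y i - c)) = (1 / r) *\<^sub>R (\<Sum>i=1..card P. f (p i) *\<^sub>R p i)"
      using r by (simp add: lam_def y_def scaleR_sum_right power2_eq_square)
    then show ?thesis by (simp only: sums(1)[of "\<lambda>y. f y *\<^sub>R y"] lin scaleR_zero_right)
  qed
  moreover have "(\<Sum>j=1..card Q. mu j *\<^sub>R (z j - d)) = 0"
  proof -
    have "(\<Sum>j=1..card Q. mu j *\<^sub>R (z j - d)) = (1 / R) *\<^sub>R (\<Sum>j=1..card Q. g (q j) *\<^sub>R q j)"
      using R by (simp add: mu_def z_def scaleR_sum_right power2_eq_square)
    then show ?thesis by (simp only: sums(2)[of "\<lambda>z. g z *\<^sub>R z"] lin scaleR_zero_right)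
  qed
  moreover have "card P \<ge> 1" "card Q \<ge> 1"
    using PQ by (auto simp: Suc_le_eq card_gt_0_iff)
  moreover have "lam i > 0" if "i \<in> {1..card P}" for i
    using pos(1)[OF pin[OF that]] r by (simp add: lam_def)
  moreover have "mu j > 0" if "j \<in> {1..card Q}" for j
    using pos(2)[OF qin[OF that]] R by (simp add: mu_def)
  ultimately have dec: "contact_decomposition K c r d R (card P) (card Q) y z lam mu"
    using yc zc unfolding contact_decomposition_def by blast
  have "real (2 * (card P + card Q)) \<le> real (CARD('n) * (CARD('n) + 5) + 2)"
    using card by (simp only: of_nat_le_iff)
  then have "real (card P + card Q) \<le> real CARD('n) * (real CARD('n) + 5) / 2 + 1" by simp
  with dec show ?thesis by blast
qed

section \<open>The equivalence\<close>

theorem theorem1p5: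
  fixes K :: "(real ^ 'n) set" and c d :: "real ^ 'n" and r R :: real
  assumes "convex_body K"
    and "r > 0" and "R \<ge> r"
    and "cball c r \<subseteq> K" and "K \<subseteq> cball d R"
  shows
    "(banach_mazur_dist K (cball 0 1) = R / r \<longleftrightarrow>
       (\<forall>(A :: real ^ 'n ^ 'n) (v :: real ^ 'n) (w :: real ^ 'n). transpose A = A \<longrightarrow>
          (\<exists>y \<in> contact_points K c r. \<exists>z \<in> contact_points K d R.
             ((y - c) /\<^sub>R r) \<bullet> (A *v ((y - c) /\<^sub>R r) + v)
               \<le> ((z - d) /\<^sub>R R) \<bullet> (A *v ((z - d) /\<^sub>R R) + w)))) \<and>
     (banach_mazur_dist K (cball 0 1) = R / r \<longleftrightarrow>
       (\<exists>N M y z lam mu. contact_decomposition K c r d R N M y z lam mu)) \<and>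
     (\<forall>N M y z lam mu. contact_decomposition K c r d R N M y z lam mu \<longrightarrow>
        r\<^sup>2 * (\<Sum>i=1..N. lam i) = R\<^sup>2 * (\<Sum>j=1..M. mu j)) \<and>
     ((\<exists>N M y z lam mu. contact_decomposition K c r d R N M y z lam mu) \<longrightarrow>
        (\<exists>N M y z lam mu. contact_decomposition K c r d R N M y z lam mu \<and>
           real (N + M) \<le> real CARD('n) * (real CARD('n) + 5) / 2 + 1))"
proof -
  have R: "R > 0" using assms(2,3) by simp
  let ?dist = "banach_mazur_dist K (cball 0 1) = R / r"
  let ?balanced = "\<forall>(A :: real ^ 'n ^ 'n) (v :: real ^ 'n) (w :: real ^ 'n). transpose A = A \<longrightarrow>
      (\<exists>y \<in> contact_points K c r. \<exists>z \<in> contact_points K d R.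
        ((y - c) /\<^sub>R r) \<bullet> (A *v ((y - c) /\<^sub>R r) + v) \<le> ((z - d) /\<^sub>R R) \<bullet> (A *v ((z - d) /\<^sub>R R) + w))"
  let ?dec = "\<exists>N M y z lam mu. contact_decomposition K c r d R N M y z lam mu"
  let ?short = "\<exists>N M y z lam mu. contact_decomposition K c r d R N M y z lam mu \<and>
      real (N + M) \<le> real CARD('n) * (real CARD('n) + 5) / 2 + 1"
  have K: "compact K" using assms(1) by (simp add: convex_body_def)
  have "?dist" if dec: "?dec"
  proof (rule antisym)
    obtain N M y z lam mu where "contact_decomposition K c r d R N M y z lam mu"
      using dec by blast
    then show "R / r \<le> banach_mazur_dist K (cball 0 1)"
      by (rule contact_decomposition_imp_dist[OF assms(1,2) R assms(4,5)])
    show "banach_mazur_dist K (cball 0 1) \<le> R / r"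
      by (rule banach_mazur_dist_le_ratio[OF assms(2) R assms(4,5)])
  qed
  moreover have "?balanced" if "?dist"
  proof (intro allI impI)
    fix A :: "real ^ 'n ^ 'n" and v w
    show "\<exists>y \<in> contact_points K c r. \<exists>z \<in> contact_points K d R.
        ((y - c) /\<^sub>R r) \<bullet> (A *v ((y - c) /\<^sub>R r) + v) \<le> ((z - d) /\<^sub>R R) \<bullet> (A *v ((z - d) /\<^sub>R R) + w)"
    proof (rule ccontr)
      assume "\<not> ?thesis"
      then have "((z - d) /\<^sub>R R) \<bullet> (A *v ((z - d) /\<^sub>R R) + w) < ((y - c) /\<^sub>R r) \<bullet> (A *v ((y - c) /\<^sub>R r) + v)"
        if "y \<in> contact_points K c r" "z \<in> contact_points K d R" for y z
        using that by (meson not_le)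
      from unbalanced_contacts_imp_dist_less[OF K assms(2) R assms(4,5) matrix_vector_mul_linear this]
      show False using \<open>?dist\<close> by simp
    qed
  qed
  moreover have "?short" if "?balanced"
    by (rule short_contact_decomposition[OF assms(2) R]) (use that in blast)
  moreover have "?dec" if "?short" using that by blast
  moreover have "r\<^sup>2 * (\<Sum>i=1..N. lam i) = R\<^sup>2 * (\<Sum>j=1..M. mu j)"
    if "contact_decomposition K c r d R N M y z lam mu" for N M y z lam mu
    by (rule contact_decomposition_weights[OF that assms(2) R])
  ultimately show ?thesis by argo
qed

end
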